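(* Assume (H$_1$)–(H$_3$) (listed in the context), and let $\mathcal O_W$, $f^1,\overline G,C,Q$ be as in the context, so that the one-dimensional radiation hydrodynamics system reads $W_t+f^1(W)_x=(\overline GW_x)_x+C(W)W_x+Q(W)$. Set $$\mathcal M=\{\psi\in\mathbb{R}^4:\langle\psi,Q(W)\rangle=0\ \ \forall\,W\in\mathcal O_W\},\qquad \mathcal O_{\mathrm{eq}}=\{W\in\mathcal O_W:Q(W)=0\}.$$ Then the function $\mathcal S=-\rho s-\tfrac43\eta^{3/4}$, viewed as a function of $W\in\mathcal O_W$, is an entropy function for this system in the following sense: (a) for every $W\in\mathcal O_W$ the Hessian $D_W^2\mathcal S(W)$ is positive definite; (b') for every $W\in\mathcal O_{\mathrm{eq}}$ the matrix $(D_Wf^1(W)-C(W))\,D_W^2\mathcal S(W)^{-1}$ is symmetric; (c) for $W\in\mathcal O_W$, one has $W\in\mathcal O_{\mathrm{eq}}$ if and only if $D_W\mathcal S(W)^\top\in\mathcal M$; (d) for every $W\in\mathcal O_{\mathrm{eq}}$ the matrix $D_WQ(W)D_W^2\mathcal S(W)^{-1}$ is symmetric and non-positive definite, and its null space coincides with $\mathcal M$; (e) for every $W\in\mathcal O_W$ the matrix $\overline G\,D_W^2\mathcal S(W)^{-1}$ is symmetric and positive semi-definite.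
   Context: Variables: $V=(\rho,u,\theta,\eta)$ with $\rho,\theta,\eta>0$, $u\in\mathbb{R}$, and $W=(\rho,m,\mathcal E,\eta)$ with $m=\rho u$, $\mathcal E=\rho(e(\rho,\theta)+u^2/2)$. Since $e_\theta>0$, $V\mapsto W$ is a diffeomorphism of $\{\rho>0,u\in\mathbb{R},\theta>0,\eta>0\}$ onto its image $\mathcal O_W\subset\mathbb{R}^4$; $u,\theta,p,e,s$ are regarded as functions of $W$ through its inverse. Put $$f^1(W)=\begin{pmatrix}\rho u\\ \rho u^2+p+\tfrac13\eta\\ \mathcal Eu+(p+\tfrac13\eta)u\\ \eta u\end{pmatrix},\quad Q(W)=\begin{pmatrix}0\\0\\ \sigma_a(\eta-\theta^4)\\-\sigma_a(\eta-\theta^4)\end{pmatrix},$$ $$C(W)=\begin{pmatrix}0&0&0&0\\0&0&0&0\\-\frac{u\eta}{3\rho}&\frac{\eta}{3\rho}&0&0\\ \frac{u\eta}{3\rho}&-\frac{\eta}{3\rho}&0&0\end{pmatrix},\quad \overline G=\mathrm{diag}\big(0,0,0,\tfrac1{3\sigma_s}\big).$$ Assumptions: (H$_1$) the independent thermodynamic variables $(\rho,\theta)$ take values in $\mathcal D=\{\rho>0,\theta>0\}$. (H$_2$) the pressure $p$, internal energy $e$ and specific entropy $s$ of the fluid are $C^\infty$ functions on $\mathcal D$ with $p>0$, $p_\rho>0$, $p_\theta>0$, $e_\theta>0$, satisfying $de=\theta\,ds-p\,d(1/\rho)$, i.e. $e_\rho=(p-\theta p_\theta)/\rho^2$, $s_\rho=-p_\theta/\rho^2$,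 $s_\theta=e_\theta/\theta$. (H$_3$) $\sigma_a,\sigma_s$ are positive constants. *)

theory Defs
  imports "HOL-Analysis.Analysis"
begin

section \<open>Smooth functions and matrix notions\<close>

text \<open>Differentiability is taken with respect to the full filter \<open>at x\<close>, so \<open>S\<close> is meant to be open.\<close>

primrec Ck_on ::
  "nat \<Rightarrow> 'a::real_normed_vector set \<Rightarrow> ('a \<Rightarrow> 'b::real_normed_vector) \<Rightarrow> bool" where
  "Ck_on 0 S f \<longleftrightarrow> continuous_on S f"
| "Ck_on (Suc k) S f \<longleftrightarrow>
     (\<forall>x\<in>S. f differentiable (at x)) \<and> (\<forall>v. Ck_on k S (\<lambda>x. frechet_derivative f (at x) v))"

definition Cinf_on :: "'a::real_normed_vector set \<Rightarrow> ('a \<Rightarrow> 'b::real_normed_vector) \<Rightarrow> bool" where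
  "Cinf_on S f \<longleftrightarrow> (\<forall>k. Ck_on k S f)"

definition grad :: "(real^'n \<Rightarrow> real) \<Rightarrow> real^'n \<Rightarrow> real^'n" where
  "grad f x = (\<chi> i. frechet_derivative f (at x) (axis i 1))"

definition hessian :: "(real^'n \<Rightarrow> real) \<Rightarrow> real^'n \<Rightarrow> real^'n^'n" where
  "hessian f x = jacobian (grad f) (at x)"

definition symmetric_mat :: "real^'n^'n \<Rightarrow> bool" where
  "symmetric_mat A \<longleftrightarrow> transpose A = A"

definition pos_definite :: "real^'n^'n \<Rightarrow> bool" where
  "pos_definite A \<longleftrightarrow> symmetric_mat A \<and> (\<forall>x. x \<noteq> 0 \<longrightarrow> x \<bullet> (A *v x) > 0)"

definition pos_semidefinite :: "real^'n^'n \<Rightarrow> bool" where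
  "pos_semidefinite A \<longleftrightarrow> symmetric_mat A \<and> (\<forall>x. x \<bullet> (A *v x) \<ge> 0)"

definition nonpos_definite :: "real^'n^'n \<Rightarrow> bool" where
  "nonpos_definite A \<longleftrightarrow> symmetric_mat A \<and> (\<forall>x. x \<bullet> (A *v x) \<le> 0)"

definition null_space :: "real^'n^'m \<Rightarrow> (real^'n) set" where
  "null_space A = {x. A *v x = 0}"

lemma vector_4 [simp]:
  "(vector [a,b,c,d] :: 'a::zero^4) $ 1 = a"
  "(vector [a,b,c,d] :: 'a::zero^4) $ 2 = b"
  "(vector [a,b,c,d] :: 'a::zero^4) $ 3 = c"
  "(vector [a,b,c,d] :: 'a::zero^4) $ 4 = d"
  unfolding vector_def by simp_all


section \<open>Thermodynamics of the fluid\<close>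

text \<open>State functions take the density as first and the temperature as second argument.\<close>

definition thermo_domain :: "(real \<times> real) set" where
  "thermo_domain = {(\<rho>, \<theta>). \<rho> > 0 \<and> \<theta> > 0}"

definition d_rho :: "(real \<Rightarrow> real \<Rightarrow> real) \<Rightarrow> real \<Rightarrow> real \<Rightarrow> real" where
  "d_rho g \<rho> \<theta> = deriv (\<lambda>r. g r \<theta>) \<rho>"

definition d_theta :: "(real \<Rightarrow> real \<Rightarrow> real) \<Rightarrow> real \<Rightarrow> real \<Rightarrow> real" where
  "d_theta g \<rho> \<theta> = deriv (\<lambda>t. g \<rho> t) \<theta>"

text \<open>The differential relation \<open>de = \<theta> ds - p d(1/\<rho>)\<close> at \<open>(\<rho>, \<theta>)\<close>.\<close>

definition gibbs_relation ::
  "(real \<Rightarrow> real \<Rightarrow> real) \<Rightarrow> (real \<Rightarrow> real \<Rightarrow> real) \<Rightarrow> (real \<Rightarrow> real \<Rightarrow> real)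
    \<Rightarrow> real \<Rightarrow> real \<Rightarrow> bool" where
  "gibbs_relation p e s \<rho> \<theta> \<longleftrightarrow>
     (\<forall>h. frechet_derivative (\<lambda>(r, t). e r t) (at (\<rho>, \<theta>)) h
        = \<theta> * frechet_derivative (\<lambda>(r, t). s r t) (at (\<rho>, \<theta>)) h
          - p \<rho> \<theta> * frechet_derivative (\<lambda>(r, t). 1 / r) (at (\<rho>, \<theta> :: real)) h)"


section \<open>State variables\<close>

text \<open>Primitive variables are \<open>V = (\<rho>, u, \<theta>, \<eta>)\<close>, conserved variables \<open>W = (\<rho>, m, E, \<eta>)\<close>.\<close>

definition prim_states :: "(real^4) set" where
  "prim_states = {V. V $ 1 > 0 \<and> V $ 3 > 0 \<and> V $ 4 > 0}"

definition conserved :: "(real \<Rightarrow> real \<Rightarrow> real) \<Rightarrow> real^4 \<Rightarrow> real^4" where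
  "conserved e V =
     vector [V $ 1, V $ 1 * V $ 2, V $ 1 * (e (V $ 1) (V $ 3) + (V $ 2)\<^sup>2 / 2), V $ 4]"

definition O_W :: "(real \<Rightarrow> real \<Rightarrow> real) \<Rightarrow> (real^4) set" where
  "O_W e = conserved e ` prim_states"

definition primitive :: "(real \<Rightarrow> real \<Rightarrow> real) \<Rightarrow> real^4 \<Rightarrow> real^4" where
  "primitive e = inv_into prim_states (conserved e)"

definition velocity :: "(real \<Rightarrow> real \<Rightarrow> real) \<Rightarrow> real^4 \<Rightarrow> real" where
  "velocity e W = primitive e W $ 2"

definition temperature :: "(real \<Rightarrow> real \<Rightarrow> real) \<Rightarrow> real^4 \<Rightarrow> real" where
  "temperature e W = primitive e W $ 3"

text \<open>For \<open>e\<^sub>\<theta> > 0\<close> the map from primitive to conserved variables is injective, so that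
  \<^const>\<open>primitive\<close> is its genuine inverse.\<close>

lemma inj_on_conserved:
  assumes diff: "\<And>\<rho> \<theta>. \<rho> > 0 \<Longrightarrow> \<theta> > 0 \<Longrightarrow> (\<lambda>(r, t). e r t) differentiable (at (\<rho>, \<theta>))"
    and pos: "\<And>\<rho> \<theta>. \<rho> > 0 \<Longrightarrow> \<theta> > 0 \<Longrightarrow> d_theta e \<rho> \<theta> > 0"
  shows "inj_on (conserved e) prim_states"
proof (rule inj_onI)
  have mono: "e \<rho> a < e \<rho> b" if "\<rho> > 0" "a > 0" "a < b" for \<rho> a b
  proof (rule DERIV_pos_imp_increasing[OF \<open>a < b\<close>])
    fix t assume t: "a \<le> t" "t \<le> b"
    then have "t > 0" using that by simp
    then obtain D where "((\<lambda>(r, t). e r t) has_derivative D) (at (\<rho>, t))"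
      using diff[OF \<open>\<rho> > 0\<close>] unfolding differentiable_def by blast
    moreover have "((\<lambda>t. (\<rho>, t)) has_derivative (\<lambda>h. (0, h))) (at t)"
      by (auto intro!: derivative_eq_intros)
    ultimately have "((\<lambda>t. e \<rho> t) has_derivative (\<lambda>h. D (0, h))) (at t)"
      using has_derivative_compose[of "\<lambda>t. (\<rho>, t)" _ t UNIV "\<lambda>(r, t). e r t" D] by simp
    then have "(\<lambda>t. e \<rho> t) differentiable (at t)"
      unfolding differentiable_def by blast
    then have "((\<lambda>t. e \<rho> t) has_real_derivative d_theta e \<rho> t) (at t)"
      unfolding d_theta_def by (simp add: DERIV_deriv_iff_real_differentiable)
    then show "\<exists>y. ((\<lambda>t. e \<rho> t) has_real_derivative y) (at t) \<and> 0 < y"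
      using pos[OF \<open>\<rho> > 0\<close> \<open>t > 0\<close>] by blast
  qed
  fix X Y assume X: "X \<in> prim_states" and Y: "Y \<in> prim_states"
    and eq: "conserved e X = conserved e Y"
  have "conserved e X $ i = conserved e Y $ i" for i
    using eq by simp
  from this[of 1] this[of 2] this[of 3] this[of 4]
  have 1: "X $ 1 = Y $ 1" and 4: "X $ 4 = Y $ 4" and m: "X $ 1 * X $ 2 = Y $ 1 * Y $ 2"
    and E: "X $ 1 * (e (X $ 1) (X $ 3) + (X $ 2)\<^sup>2 / 2) = Y $ 1 * (e (Y $ 1) (Y $ 3) + (Y $ 2)\<^sup>2 / 2)"
    by (simp_all add: conserved_def)
  have p: "X $ 1 > 0" "X $ 3 > 0" "Y $ 3 > 0"
    using X Y by (auto simp: prim_states_def)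
  have 2: "X $ 2 = Y $ 2"
    using m 1 p by simp
  have "e (X $ 1) (X $ 3) = e (X $ 1) (Y $ 3)"
    using E 1 2 p by simp
  then have 3: "X $ 3 = Y $ 3"
    using mono[OF p(1,2), of "Y $ 3"] mono[OF p(1,3), of "X $ 3"] by force
  show "X = Y"
    using 1 2 3 4 by (simp add: vec_eq_iff forall_4)
qed


section \<open>The radiation hydrodynamics system\<close>

definition flux :: "(real \<Rightarrow> real \<Rightarrow> real) \<Rightarrow> (real \<Rightarrow> real \<Rightarrow> real) \<Rightarrow> real^4 \<Rightarrow> real^4" where
  "flux p e W =
     (let \<rho> = W $ 1; E = W $ 3; \<eta> = W $ 4; u = velocity e W; P = p \<rho> (temperature e W)
      in vector [\<rho> * u, \<rho> * u\<^sup>2 + P + \<eta> / 3, E * u + (P + \<eta> / 3) * u, \<eta> * u])"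

definition source :: "(real \<Rightarrow> real \<Rightarrow> real) \<Rightarrow> real \<Rightarrow> real^4 \<Rightarrow> real^4" where
  "source e \<sigma>\<^sub>a W =
     (let \<eta> = W $ 4; \<theta> = temperature e W
      in vector [0, 0, \<sigma>\<^sub>a * (\<eta> - \<theta> ^ 4), - (\<sigma>\<^sub>a * (\<eta> - \<theta> ^ 4))])"

definition coupling :: "(real \<Rightarrow> real \<Rightarrow> real) \<Rightarrow> real^4 \<Rightarrow> real^4^4" where
  "coupling e W =
     (let \<rho> = W $ 1; \<eta> = W $ 4; u = velocity e W
      in vector [vector [0, 0, 0, 0],
                 vector [0, 0, 0, 0],
                 vector [- (u * \<eta> / (3 * \<rho>)), \<eta> / (3 * \<rho>), 0, 0],
                 vector [u * \<eta> / (3 * \<rho>), - (\<eta> / (3 * \<rho>)), 0, 0]])"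

definition diffusion :: "real \<Rightarrow> real^4^4" where
  "diffusion \<sigma>\<^sub>s =
     vector [vector [0, 0, 0, 0],
             vector [0, 0, 0, 0],
             vector [0, 0, 0, 0],
             vector [0, 0, 0, 1 / (3 * \<sigma>\<^sub>s)]]"

definition collision_invariants :: "(real \<Rightarrow> real \<Rightarrow> real) \<Rightarrow> real \<Rightarrow> (real^4) set" where
  "collision_invariants e \<sigma>\<^sub>a = {\<psi>. \<forall>W\<in>O_W e. \<psi> \<bullet> source e \<sigma>\<^sub>a W = 0}"

definition O_eq :: "(real \<Rightarrow> real \<Rightarrow> real) \<Rightarrow> real \<Rightarrow> (real^4) set" where
  "O_eq e \<sigma>\<^sub>a = {W \<in> O_W e. source e \<sigma>\<^sub>a W = 0}"

definition entropy :: "(real \<Rightarrow> real \<Rightarrow> real) \<Rightarrow> (real \<Rightarrow> real \<Rightarrow> real) \<Rightarrow> real^4 \<Rightarrow> real" where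
  "entropy e s W =
     - (W $ 1 * s (W $ 1) (temperature e W)) - 4 / 3 * W $ 4 powr (3 / 4)"

end

theory Submission
  imports Defs
begin

text \<open>
  Everything is computed in the primitive variables \<open>V = (\<rho>, u, \<theta>, \<eta>)\<close>, where the derivatives are explicit.
  Write \<open>A\<close> for the derivative of \<open>W\<close> with respect to \<open>V\<close> and \<open>B = A\<^sup>-\<^sup>1\<close> for that of \<open>V\<close> with respect
  to \<open>W\<close>. The set \<open>O_W\<close> is open by invariance of domain and \<open>W \<mapsto> V\<close> is differentiable by the
  inverse function theorem, so every function of \<open>W\<close> may be differentiated by the chain rule
  (\<open>has_derivative_along_primitive\<close>).

  By the relation \<open>\<theta> ds = de - p / \<rho>\<^sup>2 d\<rho>\<close>, the gradient of the entropy involves no derivative of the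
  state functions:
  \<open>D\<^sub>W S = ((e + p / \<rho> - u\<^sup>2 / 2) / \<theta> - s, u / \<theta>, - 1 / \<theta>, - \<eta> powr (- 1 / 4))\<close>.
  The Hessian is then explicit in first partial derivatives, and the same relation turns it into a
  congruence of a diagonal matrix (\<open>hessian_entropy\<close>),
  \<open>D\<^sub>W\<^sup>2 S = B\<^sup>T L B\<close> with \<open>L = diag (p\<^sub>\<rho> / (\<rho> \<theta>), \<rho> / \<theta>, \<rho> e\<^sub>\<theta> / \<theta>\<^sup>2, \<eta> powr (- 5 / 4) / 4)\<close>.
  Thermodynamic stability \<open>p\<^sub>\<rho>, e\<^sub>\<theta> > 0\<close> makes \<open>L\<close> positive, which is (a), and the inverse Hessian is
  \<open>A L\<^sup>-\<^sup>1 A\<^sup>T\<close>.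

  The other claims become identities between explicit 4 by 4 matrices.
  For (b'), \<open>D\<^sub>W f - C = A N B\<close> where \<open>N\<close> is the matrix of the system written in quasilinear form for \<open>V\<close>
  (\<open>flux_jac_minus_coupling\<close>); the product with the inverse Hessian is \<open>A (N L\<^sup>-\<^sup>1) A\<^sup>T\<close>, and \<open>N L\<^sup>-\<^sup>1\<close> is
  symmetric as soon as \<open>\<eta> = \<theta>\<^sup>4\<close>. The only entries needing equilibrium are those
  coupling \<open>u\<close> and \<open>\<eta>\<close>. For (c), \<open>\<M>\<close> is the hyperplane \<open>\<psi>\<^sub>3 = \<psi>\<^sub>4\<close>, and the last two entries of the
  gradient agree exactly when \<open>\<eta> = \<theta>\<^sup>4\<close>. For (d), at equilibrium the product is
  \<open>- 4 \<sigma>\<^sub>a \<theta>\<^sup>5 r r\<^sup>T\<close> with \<open>r = (0, 0, 1, - 1)\<close> (\<open>source_hessian_inv\<close>), whose null space is \<open>r\<^sup>\<bottom> = \<M>\<close>.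
  For (e), \<open>\<eta>\<close> is itself both a primitive and a conserved variable, so only the last diagonal entry
  of the inverse Hessian is seen.
\<close>

section \<open>Derivatives of maps between coordinate spaces\<close>

lemma has_derivative_matrixI:
  fixes f :: "real^'n \<Rightarrow> real^'m"
  assumes "\<And>i. ((\<lambda>x. f x $ i) has_derivative (\<lambda>h. M $ i \<bullet> h)) (at x)"
  shows "(f has_derivative (*v) M) (at x)"
proof (subst has_derivative_componentwise_within, rule ballI)
  fix b :: "real^'m" assume "b \<in> Basis"
  then obtain i where b: "b = axis i 1"
    by (auto simp: Basis_vec_def)
  show "((\<lambda>x. f x \<bullet> b) has_derivative (\<lambda>h. (M *v h) \<bullet> b)) (at x)"
    using assms[of i] by (simp add: b inner_axis matrix_vector_mul_component)
qed

lemma has_derivative_vec_nth: "((\<lambda>x. x $ i) has_derivative (\<lambda>h. h $ i)) F"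
  using bounded_linear_imp_has_derivative[OF bounded_linear_vec_nth] .

lemma jacobian_eqI:
  fixes f :: "real^'n \<Rightarrow> real^'m"
  shows "(f has_derivative (*v) M) (at x) \<Longrightarrow> jacobian f (at x) = M"
  unfolding jacobian_def using frechet_derivative_at[of f "(*v) M" x] matrix_of_matrix_vector_mul[of M]
  by simp

lemma grad_eqI:
  assumes "(f has_derivative (\<lambda>h. g \<bullet> h)) (at x)"
  shows "grad f x = g"
proof -
  have "frechet_derivative f (at x) = (\<lambda>h. g \<bullet> h)"
    using frechet_derivative_at[OF assms] by simp
  then show ?thesis
    by (simp add: grad_def vec_eq_iff inner_axis)
qed

lemma has_derivative_vec_nth_powr:
  assumes "V $ i > 0"
  shows "((\<lambda>V::real^'n. V $ i powr a) has_derivative (\<lambda>h. a * (V $ i) powr (a - 1) * h $ i)) (at V)"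
proof -
  have "((\<lambda>x. x powr a) has_derivative (*) (a * (V $ i) powr (a - 1))) (at (V $ i))"
    using has_real_derivative_powr[OF assms, of a] by (simp add: has_field_derivative_def)
  with has_derivative_vec_nth show ?thesis
    by (rule has_derivative_compose)
qed

section \<open>Congruence transformations of matrices\<close>

lemma matrix_inv_eqI:
  fixes X H :: "real^'n^'n"
  assumes "X ** H = mat 1"
  shows "matrix_inv H = X"
proof -
  have *: "H ** X = mat 1"
    using assms matrix_left_right_inverse by blast
  have "\<exists>Y. H ** Y = mat 1 \<and> Y ** H = mat 1"
    using * assms by blast
  then have "H ** matrix_inv H = mat 1"
    unfolding matrix_inv_def by (rule someI2_ex) blast
  then show ?thesis
    by (metis assms matrix_mul_assoc matrix_mul_lid matrix_mul_rid)
qed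

lemma symmetric_mat_congruence:
  fixes A N :: "real^'n^'n"
  assumes "symmetric_mat N"
  shows "symmetric_mat (A ** N ** transpose A)"
  using assms by (simp add: symmetric_mat_def matrix_transpose_mul matrix_mul_assoc)

lemma matrix_diff_rdistrib:
  fixes A B :: "real^'n^'m"
  shows "(A - B) ** C = A ** C - B ** C"
  by (simp add: vec_eq_iff matrix_matrix_mult_def left_diff_distrib sum_subtractf)

definition diag4 :: "real \<Rightarrow> real \<Rightarrow> real \<Rightarrow> real \<Rightarrow> real^4^4" where
  "diag4 a b c d =
     vector [vector [a, 0, 0, 0], vector [0, b, 0, 0], vector [0, 0, c, 0], vector [0, 0, 0, d]]"

lemmas mat4_simps = vec_eq_iff forall_4 sum_4 matrix_matrix_mult_def matrix_vector_mult_def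
  transpose_def mat_def inner_vec_def

text \<open>Since \<open>B\<close> is injective, the quadratic form at \<open>x\<close> is a positive combination of the squared
  coordinates of \<open>B x \<noteq> 0\<close>.\<close>

lemma pos_definite_diag4_congruence:
  fixes A B :: "real^4^4"
  assumes pos: "a > 0" "b > 0" "c > 0" "d > 0" and AB: "A ** B = mat 1"
  shows "pos_definite (transpose B ** diag4 a b c d ** B)"
  unfolding pos_definite_def
proof (intro conjI allI impI)
  have "symmetric_mat (diag4 a b c d)"
    by (simp add: symmetric_mat_def diag4_def mat4_simps)
  from symmetric_mat_congruence[OF this, of "transpose B"]
  show "symmetric_mat (transpose B ** diag4 a b c d ** B)"
    by simp
  fix x :: "real^4" assume "x \<noteq> 0"
  define y where "y = B *v x"
  have "A *v y = x"
    by (simp add: y_def matrix_vector_mul_assoc AB)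
  with \<open>x \<noteq> 0\<close> have "y \<noteq> 0" by auto
  have "x \<bullet> ((transpose B ** diag4 a b c d ** B) *v x) = x \<bullet> (transpose B *v (diag4 a b c d *v y))"
    by (simp add: y_def matrix_vector_mul_assoc matrix_mul_assoc)
  also have "\<dots> = y \<bullet> (diag4 a b c d *v y)"
    by (simp only: y_def dot_lmul_matrix[symmetric] vector_transpose_matrix)
  also have "\<dots> = a * (y $ 1)\<^sup>2 + b * (y $ 2)\<^sup>2 + c * (y $ 3)\<^sup>2 + d * (y $ 4)\<^sup>2"
    by (simp add: diag4_def mat4_simps power2_eq_square algebra_simps)
  also have "\<dots> > 0"
  proof -
    from \<open>y \<noteq> 0\<close> have "y $ 1 \<noteq> 0 \<or> y $ 2 \<noteq> 0 \<or> y $ 3 \<noteq> 0 \<or> y $ 4 \<noteq> 0"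
      by (simp add: vec_eq_iff forall_4)
    then have "0 < a * (y $ 1)\<^sup>2 \<or> 0 < b * (y $ 2)\<^sup>2 \<or> 0 < c * (y $ 3)\<^sup>2 \<or> 0 < d * (y $ 4)\<^sup>2"
      using pos by auto
    moreover have "0 \<le> a * (y $ 1)\<^sup>2" "0 \<le> b * (y $ 2)\<^sup>2" "0 \<le> c * (y $ 3)\<^sup>2" "0 \<le> d * (y $ 4)\<^sup>2"
      using pos by auto
    ultimately show ?thesis by linarith
  qed
  finally show "x \<bullet> ((transpose B ** diag4 a b c d ** B) *v x) > 0" .
qed

text \<open>The rank-one form \<open>- k r r\<^sup>T\<close> with \<open>r = (0, 0, 1, - 1)\<close>: energy exchange between fluid and
  radiation that conserves the total.\<close>

definition exchange_mat :: "real \<Rightarrow> real^4^4" where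
  "exchange_mat k = vector [0, 0, vector [0, 0, - k, k], vector [0, 0, k, - k]]"

lemma nonpos_definite_exchange_mat:
  assumes "k \<ge> 0"
  shows "nonpos_definite (exchange_mat k)"
proof -
  have "x \<bullet> (exchange_mat k *v x) = - (k * (x $ 3 - x $ 4)\<^sup>2)" for x
    by (simp add: exchange_mat_def mat4_simps power2_eq_square algebra_simps)
  moreover have "symmetric_mat (exchange_mat k)"
    by (simp add: symmetric_mat_def exchange_mat_def mat4_simps)
  ultimately show ?thesis
    using assms by (simp add: nonpos_definite_def)
qed

lemma null_space_exchange_mat:
  assumes "k > 0"
  shows "null_space (exchange_mat k) = {x. x $ 3 = x $ 4}"
  using assms by (auto simp: null_space_def exchange_mat_def mat4_simps)

section \<open>Partial derivatives of state functions\<close>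

text \<open>The smoothness hypothesis speaks of the total derivative and the thermodynamic identities of
  partial ones; this is the bridge between the two.\<close>

lemma Cinf_on_has_derivative_partials:
  assumes smooth: "Cinf_on thermo_domain (\<lambda>(r, t). g r t)" and pos: "r > 0" "t > 0"
  shows "((\<lambda>(r, t). g r t) has_derivative (\<lambda>h. d_rho g r t * fst h + d_theta g r t * snd h)) (at (r, t))"
proof -
  have "Ck_on (Suc 0) thermo_domain (\<lambda>(r, t). g r t)"
    using smooth unfolding Cinf_on_def by blast
  then have "(\<lambda>(r, t). g r t) differentiable (at (r, t))"
    using pos by (auto simp: thermo_domain_def)
  then obtain D where D: "((\<lambda>(r, t). g r t) has_derivative D) (at (r, t))"
    unfolding differentiable_def by blast
  then have lin: "linear D"
    using has_derivative_linear by blast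
  have line_r: "((\<lambda>r. (r, t)) has_derivative (\<lambda>h. (h, 0))) (at r)"
    by (auto intro!: derivative_eq_intros)
  have line_t: "((\<lambda>t. (r, t)) has_derivative (\<lambda>h. (0, h))) (at t)"
    by (auto intro!: derivative_eq_intros)
  have scale: "D (h, 0) = D (1, 0) * h" "D (0, h) = D (0, 1) * h" for h
    using linear_cmul[OF lin, of h "(1, 0)"] linear_cmul[OF lin, of h "(0, 1)"] by simp_all
  have "((\<lambda>r. g r t) has_derivative (\<lambda>h. D (h, 0))) (at r)"
    using has_derivative_compose[OF line_r D] by simp
  moreover have "(\<lambda>h. D (h, 0)) = (*) (D (1, 0))"
    by (rule ext) (rule scale(1))
  ultimately have "((\<lambda>r. g r t) has_derivative (*) (D (1, 0))) (at r)"
    by simp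
  then have 1: "d_rho g r t = D (1, 0)"
    unfolding d_rho_def has_field_derivative_def[symmetric] by (rule DERIV_imp_deriv)
  have "((\<lambda>t. g r t) has_derivative (\<lambda>h. D (0, h))) (at t)"
    using has_derivative_compose[OF line_t D] by simp
  moreover have "(\<lambda>h. D (0, h)) = (*) (D (0, 1))"
    by (rule ext) (rule scale(2))
  ultimately have "((\<lambda>t. g r t) has_derivative (*) (D (0, 1))) (at t)"
    by simp
  then have 2: "d_theta g r t = D (0, 1)"
    unfolding d_theta_def has_field_derivative_def[symmetric] by (rule DERIV_imp_deriv)
  have "D h = d_rho g r t * fst h + d_theta g r t * snd h" for h
    using linear_add[OF lin, of "(fst h, 0)" "(0, snd h)"] scale(1)[of "fst h"] scale(2)[of "snd h"] 1 2 by simp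
  then have "D = (\<lambda>h. d_rho g r t * fst h + d_theta g r t * snd h)" by (rule ext)
  with D show ?thesis by simp
qed

lemma has_derivative_state_function:
  fixes V :: "real^4"
  assumes "Cinf_on thermo_domain (\<lambda>(r, t). g r t)" "V \<in> prim_states"
  shows "((\<lambda>V::real^4. g (V $ 1) (V $ 3)) has_derivative
      (\<lambda>h. d_rho g (V $ 1) (V $ 3) * h $ 1 + d_theta g (V $ 1) (V $ 3) * h $ 3)) (at V)"
proof -
  have "((\<lambda>V::real^4. (V $ 1, V $ 3)) has_derivative (\<lambda>h. (h $ 1, h $ 3))) (at V)"
    by (intro has_derivative_Pair has_derivative_vec_nth)
  from has_derivative_compose[OF this Cinf_on_has_derivative_partials[OF assms(1)]] assms(2)
  show ?thesis by (simp add: prim_states_def)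
qed

section \<open>The system in primitive variables\<close>

locale radiating_fluid =
  fixes p e s :: "real \<Rightarrow> real \<Rightarrow> real"
  assumes smooth_p: "Cinf_on thermo_domain (\<lambda>(\<rho>, \<theta>). p \<rho> \<theta>)"
    and smooth_e: "Cinf_on thermo_domain (\<lambda>(\<rho>, \<theta>). e \<rho> \<theta>)"
    and smooth_s: "Cinf_on thermo_domain (\<lambda>(\<rho>, \<theta>). s \<rho> \<theta>)"
    and p_rho_pos: "\<rho> > 0 \<Longrightarrow> \<theta> > 0 \<Longrightarrow> d_rho p \<rho> \<theta> > 0"
    and e_theta_pos: "\<rho> > 0 \<Longrightarrow> \<theta> > 0 \<Longrightarrow> d_theta e \<rho> \<theta> > 0"
    and e_rho: "\<rho> > 0 \<Longrightarrow> \<theta> > 0 \<Longrightarrow> d_rho e \<rho> \<theta> = (p \<rho> \<theta> - \<theta> * d_theta p \<rho> \<theta>) / \<rho>\<^sup>2"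
    and s_rho: "\<rho> > 0 \<Longrightarrow> \<theta> > 0 \<Longrightarrow> d_rho s \<rho> \<theta> = - (d_theta p \<rho> \<theta> / \<rho>\<^sup>2)"
    and s_theta: "\<rho> > 0 \<Longrightarrow> \<theta> > 0 \<Longrightarrow> d_theta s \<rho> \<theta> = d_theta e \<rho> \<theta> / \<theta>"
begin

text \<open>The matrices \<open>conserved_jac\<close> and, further below, \<open>flux_jac\<close> and \<open>source_jac\<close> are derivatives with
  respect to the primitive variables. The matrix \<open>primitive_jac V\<close> is the derivative
  of \<open>V\<close> with respect to the conserved variables, taken at \<open>conserved e V\<close>; its third row expresses
  \<open>\<rho> e\<^sub>\<theta> d\<theta> = dE - u dm - (e + \<rho> e\<^sub>\<rho> - u\<^sup>2 / 2) d\<rho>\<close>.\<close>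

definition conserved_jac :: "real^4 \<Rightarrow> real^4^4" where
  "conserved_jac V = (let \<rho> = V $ 1; u = V $ 2; \<theta> = V $ 3 in
     vector [vector [1, 0, 0, 0],
             vector [u, \<rho>, 0, 0],
             vector [e \<rho> \<theta> + \<rho> * d_rho e \<rho> \<theta> + u\<^sup>2 / 2, \<rho> * u, \<rho> * d_theta e \<rho> \<theta>, 0],
             vector [0, 0, 0, 1]])"

definition primitive_jac :: "real^4 \<Rightarrow> real^4^4" where
  "primitive_jac V = (let \<rho> = V $ 1; u = V $ 2; \<theta> = V $ 3; c = \<rho> * d_theta e \<rho> \<theta> in
     vector [vector [1, 0, 0, 0],
             vector [- (u / \<rho>), 1 / \<rho>, 0, 0],
             vector [- ((e \<rho> \<theta> + \<rho> * d_rho e \<rho> \<theta> - u\<^sup>2 / 2) / c), - (u / c), 1 / c, 0],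
             vector [0, 0, 0, 1]])"

lemma state_pos:
  assumes "V \<in> prim_states"
  shows "V $ 1 > 0" "V $ 3 > 0" "V $ 4 > 0" "d_theta e (V $ 1) (V $ 3) > 0"
    "d_rho p (V $ 1) (V $ 3) > 0"
  using assms e_theta_pos p_rho_pos by (auto simp: prim_states_def)

lemma conserved_jac_primitive_jac:
  assumes "V \<in> prim_states"
  shows "conserved_jac V ** primitive_jac V = mat 1"
  using state_pos[OF assms]
  by (simp add: conserved_jac_def primitive_jac_def Let_def mat4_simps field_simps power2_eq_square)

lemma primitive_jac_conserved_jac: "V \<in> prim_states \<Longrightarrow> primitive_jac V ** conserved_jac V = mat 1"
  using conserved_jac_primitive_jac matrix_left_right_inverse by blast

lemmas has_derivative_p = has_derivative_state_function[OF smooth_p]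
lemmas has_derivative_e = has_derivative_state_function[OF smooth_e]
lemmas has_derivative_s = has_derivative_state_function[OF smooth_s]

lemma has_derivative_conserved:
  assumes V: "V \<in> prim_states"
  shows "(conserved e has_derivative (*v) (conserved_jac V)) (at V)"
proof (rule has_derivative_matrixI)
  note rules = derivative_intros has_derivative_vec_nth has_derivative_e[OF V]
  have "((\<lambda>x. conserved e x $ 1) has_derivative (\<lambda>h. conserved_jac V $ 1 \<bullet> h)) (at V)"
    unfolding conserved_def conserved_jac_def Let_def vector_4
    by (rule has_derivative_eq_rhs, (rule rules)+) (simp add: inner_vec_def sum_4)
  moreover have "((\<lambda>x. conserved e x $ 2) has_derivative (\<lambda>h. conserved_jac V $ 2 \<bullet> h)) (at V)"
    unfolding conserved_def conserved_jac_def Let_def vector_4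
    by (rule has_derivative_eq_rhs, (rule rules)+) (simp add: inner_vec_def sum_4 algebra_simps)
  moreover have "((\<lambda>x. conserved e x $ 3) has_derivative (\<lambda>h. conserved_jac V $ 3 \<bullet> h)) (at V)"
    unfolding conserved_def conserved_jac_def Let_def vector_4
    by (rule has_derivative_eq_rhs, (rule rules)+)
       (simp_all add: inner_vec_def sum_4 fun_eq_iff field_simps power2_eq_square)
  moreover have "((\<lambda>x. conserved e x $ 4) has_derivative (\<lambda>h. conserved_jac V $ 4 \<bullet> h)) (at V)"
    unfolding conserved_def conserved_jac_def Let_def vector_4
    by (rule has_derivative_eq_rhs, (rule rules)+) (simp add: inner_vec_def sum_4)
  ultimately show "((\<lambda>x. conserved e x $ i) has_derivative (\<lambda>h. conserved_jac V $ i \<bullet> h)) (at V)" for i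
    using exhaust_4[of i] by auto
qed

lemma differentiable_e:
  "\<rho> > 0 \<Longrightarrow> \<theta> > 0 \<Longrightarrow> (\<lambda>(r, t). e r t) differentiable (at (\<rho>, \<theta>))"
  using Cinf_on_has_derivative_partials[OF smooth_e] unfolding differentiable_def by blast

lemma inj_on_conserved_prim_states: "inj_on (conserved e) prim_states"
  using inj_on_conserved differentiable_e e_theta_pos by blast

lemma primitive_conserved: "V \<in> prim_states \<Longrightarrow> primitive e (conserved e V) = V"
  unfolding primitive_def using inj_on_conserved_prim_states by (rule inv_into_f_f)

lemma open_prim_states: "open prim_states"
  unfolding prim_states_def
  by (intro open_Collect_conj open_Collect_less continuous_intros)

text \<open>Openness lets identities that hold on \<open>O_W\<close> only, such as
  \<open>grad_entropy\<close> below, be differentiated.\<close>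

lemma open_O_W: "open (O_W e)"
proof -
  have "continuous_on prim_states (conserved e)"
    using has_derivative_continuous[OF has_derivative_conserved]
    by (intro continuous_at_imp_continuous_on) blast
  then show ?thesis
    unfolding O_W_def using open_prim_states inj_on_conserved_prim_states by (rule invariance_of_domain)
qed

lemma has_derivative_primitive:
  assumes "V \<in> prim_states"
  shows "(primitive e has_derivative (*v) (primitive_jac V)) (at (conserved e V))"
proof (rule has_derivative_inverse_on[OF open_prim_states has_derivative_conserved primitive_conserved])
  show "(*v) (conserved_jac V) \<circ> (*v) (primitive_jac V) = id"
    using conserved_jac_primitive_jac[OF assms] by (simp add: fun_eq_iff matrix_vector_mul_assoc)
qed (use assms in auto)

text \<open>The chain rule that replaces every computation in \<open>W\<close> by one in \<open>V\<close>.\<close>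

lemma has_derivative_along_primitive:
  assumes V: "V \<in> prim_states"
    and F: "(F has_derivative F') (at V)"
    and f: "\<And>U. U \<in> prim_states \<Longrightarrow> f (conserved e U) = F U"
  shows "(f has_derivative (\<lambda>h. F' (primitive_jac V *v h))) (at (conserved e V))"
proof -
  have "((\<lambda>W. F (primitive e W)) has_derivative (\<lambda>h. F' (primitive_jac V *v h))) (at (conserved e V))"
    using has_derivative_compose[OF has_derivative_primitive[OF V], of F F'] F
    by (simp add: primitive_conserved[OF V])
  then show ?thesis
  proof (rule has_derivative_transform_within_open[OF _ open_O_W])
    show "conserved e V \<in> O_W e"
      using V by (simp add: O_W_def)
    show "F (primitive e W) = f W" if "W \<in> O_W e" for W
      using that f primitive_conserved by (auto simp: O_W_def)
  qed
qed

lemma has_derivative_along_primitive_matrix: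
  assumes "V \<in> prim_states"
    and "(F has_derivative (*v) M) (at V)"
    and "\<And>U. U \<in> prim_states \<Longrightarrow> f (conserved e U) = F U"
  shows "(f has_derivative (*v) (M ** primitive_jac V)) (at (conserved e V))"
  using has_derivative_along_primitive[OF assms] by (simp add: matrix_vector_mul_assoc)

section \<open>Gradient and Hessian of the entropy\<close>

text \<open>The gradient of the entropy in terms of \<open>V\<close>; its first entry is the Gibbs potential less the
  kinetic energy, divided by \<open>\<theta>\<close>.\<close>

definition entropy_variables :: "real^4 \<Rightarrow> real^4" where
  "entropy_variables V = (let \<rho> = V $ 1; u = V $ 2; \<theta> = V $ 3; \<eta> = V $ 4 in
     vector [(e \<rho> \<theta> + p \<rho> \<theta> / \<rho> - u\<^sup>2 / 2) / \<theta> - s \<rho> \<theta>, u / \<theta>, - (1 / \<theta>), - (\<eta> powr (- (1 / 4)))])"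

text \<open>The identities for \<open>s\<^sub>\<rho>\<close>, \<open>s\<^sub>\<theta>\<close> and \<open>e\<^sub>\<rho>\<close> make all partial derivatives cancel, leaving only
  values of the state functions.\<close>

lemma has_derivative_entropy:
  assumes V: "V \<in> prim_states"
  shows "(entropy e s has_derivative (\<lambda>h. entropy_variables V \<bullet> h)) (at (conserved e V))"
proof -
  define F where "F = (\<lambda>V::real^4. - (V $ 1 * s (V $ 1) (V $ 3)) - 4 / 3 * V $ 4 powr (3 / 4))"
  note rules = derivative_intros has_derivative_vec_nth has_derivative_s[OF V]
    has_derivative_vec_nth_powr[OF state_pos(3)[OF V]]
  define F' where "F' = (\<lambda>h::real^4.
      - (s (V $ 1) (V $ 3) + V $ 1 * d_rho s (V $ 1) (V $ 3)) * h $ 1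
      - V $ 1 * d_theta s (V $ 1) (V $ 3) * h $ 3 - V $ 4 powr (- (1 / 4)) * h $ 4)"
  have F': "(F has_derivative F') (at V)"
    unfolding F_def F'_def
    by (rule has_derivative_eq_rhs, (rule rules)+) (simp add: fun_eq_iff algebra_simps)
  have "entropy e s (conserved e U) = F U" if "U \<in> prim_states" for U
    using primitive_conserved[OF that] by (simp add: entropy_def temperature_def F_def conserved_def)
  from has_derivative_along_primitive[OF V F' this]
  have "(entropy e s has_derivative (\<lambda>h. F' (primitive_jac V *v h))) (at (conserved e V))" .
  moreover have "F' (primitive_jac V *v h) = entropy_variables V \<bullet> h" for h
    using state_pos[OF V]
    by (simp add: F'_def primitive_jac_def entropy_variables_def Let_def mat4_simps s_rho s_theta e_rho
        field_simps power2_eq_square)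
  ultimately show ?thesis by simp
qed

lemma grad_entropy: "V \<in> prim_states \<Longrightarrow> grad (entropy e s) (conserved e V) = entropy_variables V"
  by (rule grad_eqI[OF has_derivative_entropy])

text \<open>The diagonal matrix \<open>L\<close>: the second differential of the entropy is
  \<open>p\<^sub>\<rho> / (\<rho> \<theta>) d\<rho>\<^sup>2 + \<rho> / \<theta> du\<^sup>2 + \<rho> e\<^sub>\<theta> / \<theta>\<^sup>2 d\<theta>\<^sup>2 + \<eta> powr (- 5 / 4) / 4 d\<eta>\<^sup>2\<close>.\<close>

definition entropy_metric :: "real^4 \<Rightarrow> real^4^4" where
  "entropy_metric V = (let \<rho> = V $ 1; \<theta> = V $ 3; \<eta> = V $ 4 in
     diag4 (d_rho p \<rho> \<theta> / (\<rho> * \<theta>)) (\<rho> / \<theta>) (\<rho> * d_theta e \<rho> \<theta> / \<theta>\<^sup>2) (\<eta> powr (- (5 / 4)) / 4))"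

definition entropy_metric_inv :: "real^4 \<Rightarrow> real^4^4" where
  "entropy_metric_inv V = (let \<rho> = V $ 1; \<theta> = V $ 3; \<eta> = V $ 4 in
     diag4 (\<rho> * \<theta> / d_rho p \<rho> \<theta>) (\<theta> / \<rho>) (\<theta>\<^sup>2 / (\<rho> * d_theta e \<rho> \<theta>)) (4 * \<eta> powr (5 / 4)))"

lemma entropy_metric_inv:
  assumes "V \<in> prim_states"
  shows "entropy_metric V ** entropy_metric_inv V = mat 1"
  using state_pos[OF assms]
  by (simp add: entropy_metric_def entropy_metric_inv_def diag4_def Let_def mat4_simps powr_minus field_simps)

text \<open>The \<open>d\<theta>\<close> terms of the first row collect to \<open>- (e + \<rho> e\<^sub>\<rho> - u\<^sup>2 / 2) / \<theta>\<^sup>2\<close>, which is again the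
  coefficient in \<open>primitive_jac\<close>; this coincidence, due to \<open>e\<^sub>\<rho> = (p - \<theta> p\<^sub>\<theta>) / \<rho>\<^sup>2\<close>, is what makes the
  Hessian diagonal in \<open>V\<close>.\<close>

lemma has_derivative_entropy_variables:
  assumes V: "V \<in> prim_states"
  shows "(entropy_variables has_derivative (*v) (transpose (primitive_jac V) ** entropy_metric V)) (at V)"
proof (rule has_derivative_matrixI)
  let ?M = "transpose (primitive_jac V) ** entropy_metric V"
  note rules = derivative_intros has_derivative_vec_nth has_derivative_s[OF V] has_derivative_e[OF V]
    has_derivative_p[OF V] has_derivative_vec_nth_powr[OF state_pos(3)[OF V]]
  note pos = state_pos[OF V]
  have nz: "V $ 1 \<noteq> 0" "V $ 3 \<noteq> 0"
    using pos by simp_all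
  note M_simps = primitive_jac_def entropy_metric_def diag4_def Let_def mat4_simps
  have "((\<lambda>x. entropy_variables x $ 1) has_derivative (\<lambda>h. ?M $ 1 \<bullet> h)) (at V)"
    unfolding entropy_variables_def Let_def vector_4
    by (rule has_derivative_eq_rhs, (rule rules nz numeral_neq_zero)+)
       (use pos in \<open>simp_all add: M_simps fun_eq_iff s_rho s_theta e_rho field_simps power2_eq_square\<close>)
  moreover have "((\<lambda>x. entropy_variables x $ 2) has_derivative (\<lambda>h. ?M $ 2 \<bullet> h)) (at V)"
    unfolding entropy_variables_def Let_def vector_4
    by (rule has_derivative_eq_rhs, (rule rules)+)
       (use pos in \<open>simp_all add: M_simps fun_eq_iff field_simps power2_eq_square\<close>)
  moreover have "((\<lambda>x. entropy_variables x $ 3) has_derivative (\<lambda>h. ?M $ 3 \<bullet> h)) (at V)"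
    unfolding entropy_variables_def Let_def vector_4
    by (rule has_derivative_eq_rhs, (rule rules)+)
       (use pos in \<open>simp_all add: M_simps fun_eq_iff field_simps power2_eq_square\<close>)
  moreover have "((\<lambda>x. entropy_variables x $ 4) has_derivative (\<lambda>h. ?M $ 4 \<bullet> h)) (at V)"
    unfolding entropy_variables_def Let_def vector_4
    by (rule has_derivative_eq_rhs, (rule rules)+)
       (use pos in \<open>simp_all add: M_simps fun_eq_iff field_simps power2_eq_square\<close>)
  ultimately show "((\<lambda>x. entropy_variables x $ i) has_derivative (\<lambda>h. ?M $ i \<bullet> h)) (at V)" for i
    using exhaust_4[of i] by auto
qed

lemma has_derivative_grad_entropy:
  assumes V: "V \<in> prim_states"
  shows "(grad (entropy e s) has_derivative (*v) (transpose (primitive_jac V) ** entropy_metric V ** primitive_jac V))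
    (at (conserved e V))"
  using has_derivative_along_primitive_matrix[OF V has_derivative_entropy_variables[OF V] grad_entropy] .

lemma hessian_entropy:
  "V \<in> prim_states \<Longrightarrow>
    hessian (entropy e s) (conserved e V) = transpose (primitive_jac V) ** entropy_metric V ** primitive_jac V"
  unfolding hessian_def by (rule jacobian_eqI[OF has_derivative_grad_entropy])

lemma pos_definite_hessian:
  assumes V: "V \<in> prim_states"
  shows "pos_definite (hessian (entropy e s) (conserved e V))"
  unfolding hessian_entropy[OF V] entropy_metric_def Let_def
  using state_pos[OF V] by (intro pos_definite_diag4_congruence[OF _ _ _ _ conserved_jac_primitive_jac[OF V]]) simp_all

lemma matrix_inv_hessian:
  assumes V: "V \<in> prim_states"
  shows "matrix_inv (hessian (entropy e s) (conserved e V)) =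
    conserved_jac V ** entropy_metric_inv V ** transpose (conserved_jac V)"
  unfolding hessian_entropy[OF V]
proof (rule matrix_inv_eqI)
  have 1: "transpose (conserved_jac V) ** transpose (primitive_jac V) = mat 1"
    by (metis primitive_jac_conserved_jac[OF V] matrix_transpose_mul transpose_mat)
  have 2: "entropy_metric_inv V ** entropy_metric V = mat 1"
    using entropy_metric_inv[OF V] matrix_left_right_inverse by blast
  have "conserved_jac V ** entropy_metric_inv V ** transpose (conserved_jac V) **
      (transpose (primitive_jac V) ** entropy_metric V ** primitive_jac V)
    = conserved_jac V **
      (entropy_metric_inv V ** ((transpose (conserved_jac V) ** transpose (primitive_jac V)) ** entropy_metric V)) **
      primitive_jac V"
    by (simp only: matrix_mul_assoc)
  also have "\<dots> = mat 1"
    by (simp only: 1 2 matrix_mul_lid matrix_mul_rid conserved_jac_primitive_jac[OF V])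
  finally show "conserved_jac V ** entropy_metric_inv V ** transpose (conserved_jac V) **
    (transpose (primitive_jac V) ** entropy_metric V ** primitive_jac V) = mat 1" .
qed

section \<open>The flux and the source\<close>

definition flux_jac :: "real^4 \<Rightarrow> real^4^4" where
  "flux_jac V = (let \<rho> = V $ 1; u = V $ 2; \<theta> = V $ 3; \<eta> = V $ 4;
       P = p \<rho> \<theta>; P\<^sub>\<rho> = d_rho p \<rho> \<theta>; P\<^sub>\<theta> = d_theta p \<rho> \<theta> in
     vector [vector [u, \<rho>, 0, 0],
             vector [u\<^sup>2 + P\<^sub>\<rho>, 2 * \<rho> * u, P\<^sub>\<theta>, 1 / 3],
             vector [(e \<rho> \<theta> + u\<^sup>2 / 2 + \<rho> * d_rho e \<rho> \<theta> + P\<^sub>\<rho>) * u,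
                     \<rho> * (e \<rho> \<theta> + u\<^sup>2 / 2) + P + \<eta> / 3 + \<rho> * u\<^sup>2,
                     (\<rho> * d_theta e \<rho> \<theta> + P\<^sub>\<theta>) * u, u / 3],
             vector [0, \<eta>, 0, u]])"

definition source_jac :: "real \<Rightarrow> real^4 \<Rightarrow> real^4^4" where
  "source_jac \<sigma>\<^sub>a V = vector [0, 0, vector [0, 0, - (4 * \<sigma>\<^sub>a * V $ 3 ^ 3), \<sigma>\<^sub>a],
     vector [0, 0, 4 * \<sigma>\<^sub>a * V $ 3 ^ 3, - \<sigma>\<^sub>a]]"

text \<open>The matrix \<open>N\<close> of the first-order part \<open>V\<^sub>t + N V\<^sub>x\<close> of the system in nonconservative form:
  \<open>\<rho>\<^sub>t + u \<rho>\<^sub>x + \<rho> u\<^sub>x\<close>,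
  \<open>u\<^sub>t + u u\<^sub>x + (p + \<eta> / 3)\<^sub>x / \<rho>\<close>,
  \<open>\<theta>\<^sub>t + u \<theta>\<^sub>x + \<theta> p\<^sub>\<theta> / (\<rho> e\<^sub>\<theta>) u\<^sub>x\<close>,
  \<open>\<eta>\<^sub>t + u \<eta>\<^sub>x + 4 / 3 \<eta> u\<^sub>x\<close>.\<close>

definition quasilinear_mat :: "real^4 \<Rightarrow> real^4^4" where
  "quasilinear_mat V = (let \<rho> = V $ 1; u = V $ 2; \<theta> = V $ 3; \<eta> = V $ 4;
       P\<^sub>\<rho> = d_rho p \<rho> \<theta>; P\<^sub>\<theta> = d_theta p \<rho> \<theta> in
     vector [vector [u, \<rho>, 0, 0],
             vector [P\<^sub>\<rho> / \<rho>, u, P\<^sub>\<theta> / \<rho>, 1 / (3 * \<rho>)],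
             vector [0, \<theta> * P\<^sub>\<theta> / (\<rho> * d_theta e \<rho> \<theta>), u, 0],
             vector [0, 4 / 3 * \<eta>, 0, u]])"

lemma has_derivative_flux:
  assumes V: "V \<in> prim_states"
  shows "(flux p e has_derivative (*v) (flux_jac V ** primitive_jac V)) (at (conserved e V))"
proof (rule has_derivative_along_primitive_matrix[OF V])
  define F where "F = (\<lambda>V::real^4. vector [V $ 1 * V $ 2,
      V $ 1 * (V $ 2)\<^sup>2 + p (V $ 1) (V $ 3) + V $ 4 / 3,
      V $ 1 * (e (V $ 1) (V $ 3) + (V $ 2)\<^sup>2 / 2) * V $ 2 + (p (V $ 1) (V $ 3) + V $ 4 / 3) * V $ 2,
      V $ 4 * V $ 2] :: real^4)"
  show "flux p e (conserved e U) = F U" if "U \<in> prim_states" for U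
    using primitive_conserved[OF that]
    by (simp add: flux_def Let_def velocity_def temperature_def F_def conserved_def)
  note rules = derivative_intros has_derivative_vec_nth has_derivative_e[OF V] has_derivative_p[OF V]
    numeral_neq_zero
  note simps = inner_vec_def sum_4 fun_eq_iff field_simps power2_eq_square
  show "(F has_derivative (*v) (flux_jac V)) (at V)"
  proof (rule has_derivative_matrixI)
    have "((\<lambda>x. F x $ 1) has_derivative (\<lambda>h. flux_jac V $ 1 \<bullet> h)) (at V)"
      unfolding F_def flux_jac_def Let_def vector_4
      by (rule has_derivative_eq_rhs, (rule rules)+) (simp_all add: simps)
    moreover have "((\<lambda>x. F x $ 2) has_derivative (\<lambda>h. flux_jac V $ 2 \<bullet> h)) (at V)"
      unfolding F_def flux_jac_def Let_def vector_4
      by (rule has_derivative_eq_rhs, (rule rules)+) (simp_all add: simps)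
    moreover have "((\<lambda>x. F x $ 3) has_derivative (\<lambda>h. flux_jac V $ 3 \<bullet> h)) (at V)"
      unfolding F_def flux_jac_def Let_def vector_4
      by (rule has_derivative_eq_rhs, (rule rules)+) (simp_all add: simps)
    moreover have "((\<lambda>x. F x $ 4) has_derivative (\<lambda>h. flux_jac V $ 4 \<bullet> h)) (at V)"
      unfolding F_def flux_jac_def Let_def vector_4
      by (rule has_derivative_eq_rhs, (rule rules)+) (simp_all add: simps)
    ultimately show "((\<lambda>x. F x $ i) has_derivative (\<lambda>h. flux_jac V $ i \<bullet> h)) (at V)" for i
      using exhaust_4[of i] by auto
  qed
qed

lemma source_conserved:
  "V \<in> prim_states \<Longrightarrow> source e \<sigma>\<^sub>a (conserved e V) =
     vector [0, 0, \<sigma>\<^sub>a * (V $ 4 - V $ 3 ^ 4), - (\<sigma>\<^sub>a * (V $ 4 - V $ 3 ^ 4))]"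
  using primitive_conserved[of V] by (simp add: source_def Let_def temperature_def conserved_def)

lemma has_derivative_source:
  assumes V: "V \<in> prim_states"
  shows "(source e \<sigma>\<^sub>a has_derivative (*v) (source_jac \<sigma>\<^sub>a V ** primitive_jac V)) (at (conserved e V))"
proof (rule has_derivative_along_primitive_matrix[OF V])
  let ?F = "\<lambda>V::real^4. vector [0, 0, \<sigma>\<^sub>a * (V $ 4 - V $ 3 ^ 4), - (\<sigma>\<^sub>a * (V $ 4 - V $ 3 ^ 4))] :: real^4"
  show "source e \<sigma>\<^sub>a (conserved e U) = ?F U" if "U \<in> prim_states" for U
    using source_conserved[OF that] .
  note rules = derivative_intros has_derivative_vec_nth
  show "(?F has_derivative (*v) (source_jac \<sigma>\<^sub>a V)) (at V)"
  proof (rule has_derivative_matrixI)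
    have "((\<lambda>x. ?F x $ 1) has_derivative (\<lambda>h. source_jac \<sigma>\<^sub>a V $ 1 \<bullet> h)) (at V)"
      by (simp add: source_jac_def)
    moreover have "((\<lambda>x. ?F x $ 2) has_derivative (\<lambda>h. source_jac \<sigma>\<^sub>a V $ 2 \<bullet> h)) (at V)"
      by (simp add: source_jac_def)
    moreover have "((\<lambda>x. ?F x $ 3) has_derivative (\<lambda>h. source_jac \<sigma>\<^sub>a V $ 3 \<bullet> h)) (at V)"
      unfolding source_jac_def vector_4
      by (rule has_derivative_eq_rhs, (rule rules)+)
         (simp_all add: inner_vec_def sum_4 fun_eq_iff algebra_simps)
    moreover have "((\<lambda>x. ?F x $ 4) has_derivative (\<lambda>h. source_jac \<sigma>\<^sub>a V $ 4 \<bullet> h)) (at V)"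
      unfolding source_jac_def vector_4
      by (rule has_derivative_eq_rhs, (rule rules)+)
         (simp_all add: inner_vec_def sum_4 fun_eq_iff algebra_simps)
    ultimately show "((\<lambda>x. ?F x $ i) has_derivative (\<lambda>h. source_jac \<sigma>\<^sub>a V $ i \<bullet> h)) (at V)" for i
      using exhaust_4[of i] by auto
  qed
qed

section \<open>Symmetry at equilibrium\<close>

text \<open>In terms of \<open>V\<close> the coupling is \<open>\<plusminus> \<eta> / 3 u\<^sub>x\<close>. It removes the work of the radiation pressure from
  the energy equation, so that only the fluid pressure enters the \<open>\<theta>\<close> row of \<open>N\<close>, and it raises the
  compression term of the radiation from \<open>\<eta> u\<^sub>x\<close> to \<open>4 / 3 \<eta> u\<^sub>x\<close>.\<close>

lemma flux_jac_minus_coupling: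
  assumes V: "V \<in> prim_states"
  shows "flux_jac V - coupling e (conserved e V) ** conserved_jac V = conserved_jac V ** quasilinear_mat V"
proof -
  have u: "velocity e (conserved e V) = V $ 2"
    by (simp add: velocity_def primitive_conserved[OF V])
  show ?thesis
    unfolding coupling_def Let_def u
    using state_pos[OF V]
    by (simp add: conserved_def flux_jac_def quasilinear_mat_def conserved_jac_def Let_def mat4_simps
        e_rho field_simps power2_eq_square)
qed

lemma fourth_power_powr:
  assumes "\<theta> > (0::real)"
  shows "(\<theta> ^ 4) powr (- (1 / 4)) = 1 / \<theta>" "(\<theta> ^ 4) powr (5 / 4) = \<theta> ^ 5"
proof -
  have "(\<theta> ^ 4) powr a = \<theta> powr (4 * a)" for a
  proof -
    have "\<theta> ^ 4 = \<theta> powr 4" using assms by simp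
    then show ?thesis by (simp only: powr_powr)
  qed
  from this[of "- (1 / 4)"] this[of "5 / 4"]
  show "(\<theta> ^ 4) powr (- (1 / 4)) = 1 / \<theta>" "(\<theta> ^ 4) powr (5 / 4) = \<theta> ^ 5"
    using assms by (simp_all add: powr_minus_divide)
qed

lemma O_eq_iff:
  assumes V: "V \<in> prim_states" and "\<sigma>\<^sub>a > 0"
  shows "conserved e V \<in> O_eq e \<sigma>\<^sub>a \<longleftrightarrow> V $ 4 = V $ 3 ^ 4"
  using assms by (simp add: O_eq_def O_W_def source_conserved vec_eq_iff forall_4)

text \<open>The entries in rows \<open>u, \<eta>\<close> are \<open>4 / 3 \<eta> powr (5 / 4) / \<rho>\<close> and \<open>4 / 3 \<eta> \<theta> / \<rho>\<close>, which agree only when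
  \<open>\<eta> powr (1 / 4) = \<theta>\<close>; all others are symmetric for every state.\<close>

lemma symmetric_quasilinear_mat:
  assumes V: "V \<in> prim_states" and eq: "V $ 4 = V $ 3 ^ 4"
  shows "symmetric_mat (quasilinear_mat V ** entropy_metric_inv V)"
proof -
  note pos = state_pos[OF V]
  have "V $ 4 powr (5 / 4) = V $ 3 * V $ 4"
    by (simp only: eq fourth_power_powr(2)[OF pos(2)]) (simp add: eval_nat_numeral)
  then show ?thesis
    using pos
    by (simp add: symmetric_mat_def quasilinear_mat_def entropy_metric_inv_def diag4_def Let_def
        mat4_simps field_simps power2_eq_square)
qed

lemma symmetric_flux:
  assumes V: "V \<in> prim_states" and eq: "V $ 4 = V $ 3 ^ 4"
  shows "symmetric_mat ((jacobian (flux p e) (at (conserved e V)) - coupling e (conserved e V))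
    ** matrix_inv (hessian (entropy e s) (conserved e V)))"
proof -
  let ?C = "coupling e (conserved e V)" and ?N = "quasilinear_mat V"
  have "flux_jac V ** primitive_jac V - ?C = (flux_jac V - ?C ** conserved_jac V) ** primitive_jac V"
    by (simp add: matrix_diff_rdistrib matrix_mul_assoc[symmetric] conserved_jac_primitive_jac[OF V])
  then have "(flux_jac V ** primitive_jac V - ?C) **
      (conserved_jac V ** entropy_metric_inv V ** transpose (conserved_jac V))
    = conserved_jac V ** ?N ** (primitive_jac V ** conserved_jac V) **
      entropy_metric_inv V ** transpose (conserved_jac V)"
    by (simp only: flux_jac_minus_coupling[OF V] matrix_mul_assoc)
  also have "\<dots> = conserved_jac V ** (?N ** entropy_metric_inv V) ** transpose (conserved_jac V)"
    by (simp only: primitive_jac_conserved_jac[OF V] matrix_mul_rid matrix_mul_assoc)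
  finally show ?thesis
    using symmetric_mat_congruence[OF symmetric_quasilinear_mat[OF assms]]
    by (simp add: jacobian_eqI[OF has_derivative_flux[OF V]] matrix_inv_hessian[OF V])
qed

section \<open>Dissipation\<close>

text \<open>With \<open>r = (0, 0, 1, - 1)\<close> the source is \<open>\<sigma>\<^sub>a (\<eta> - \<theta>\<^sup>4) r\<close>. At equilibrium the
  differential of \<open>\<eta> - \<theta>\<^sup>4\<close> is \<open>- 4 \<theta>\<^sup>5\<close> times the Hessian applied to \<open>r\<close>, because there \<open>1 / \<theta>\<^sup>2\<close>
  and \<open>\<eta> powr (- 5 / 4) / 4\<close> are in the ratio \<open>4 \<theta>\<^sup>3\<close> to \<open>1\<close>.\<close>

lemma source_hessian_inv:
  assumes V: "V \<in> prim_states" and eq: "V $ 4 = V $ 3 ^ 4"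
  shows "jacobian (source e \<sigma>\<^sub>a) (at (conserved e V)) ** matrix_inv (hessian (entropy e s) (conserved e V))
    = exchange_mat (4 * \<sigma>\<^sub>a * V $ 3 ^ 5)"
proof -
  have "jacobian (source e \<sigma>\<^sub>a) (at (conserved e V)) ** matrix_inv (hessian (entropy e s) (conserved e V))
    = source_jac \<sigma>\<^sub>a V ** (primitive_jac V ** conserved_jac V) ** entropy_metric_inv V ** transpose (conserved_jac V)"
    by (simp only: jacobian_eqI[OF has_derivative_source[OF V]] matrix_inv_hessian[OF V] matrix_mul_assoc)
  also have "\<dots> = source_jac \<sigma>\<^sub>a V ** entropy_metric_inv V ** transpose (conserved_jac V)"
    by (simp only: primitive_jac_conserved_jac[OF V] matrix_mul_rid)
  also have "\<dots> = exchange_mat (4 * \<sigma>\<^sub>a * V $ 3 ^ 5)"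
  proof -
    note pos = state_pos[OF V]
    have "V $ 4 powr (5 / 4) = V $ 3 ^ 5"
      by (simp only: eq fourth_power_powr(2)[OF pos(2)])
    then show ?thesis
      using pos
      by (simp add: exchange_mat_def source_jac_def entropy_metric_inv_def conserved_jac_def diag4_def Let_def mat4_simps
          field_simps eval_nat_numeral)
  qed
  finally show ?thesis .
qed

lemma diffusion_hessian_inv:
  assumes V: "V \<in> prim_states"
  shows "diffusion \<sigma>\<^sub>s ** matrix_inv (hessian (entropy e s) (conserved e V))
    = diag4 0 0 0 (4 * V $ 4 powr (5 / 4) / (3 * \<sigma>\<^sub>s))"
  unfolding matrix_inv_hessian[OF V]
  by (simp add: diffusion_def conserved_jac_def entropy_metric_inv_def diag4_def Let_def mat4_simps)

text \<open>The source always points along \<open>(0, 0, 1, - 1)\<close>, so one state at which it does not vanish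
  determines all invariants.\<close>

lemma collision_invariants_eq:
  assumes "\<sigma>\<^sub>a > 0"
  shows "collision_invariants e \<sigma>\<^sub>a = {\<psi>. \<psi> $ 3 = \<psi> $ 4}"
proof (intro equalityI subsetI)
  fix \<psi> :: "real^4"
  assume \<psi>: "\<psi> \<in> collision_invariants e \<sigma>\<^sub>a"
  \<comment> \<open>A state off equilibrium: \<open>\<theta> = 1\<close> but \<open>\<eta> = 2\<close>.\<close>
  define V :: "real^4" where "V = vector [1, 0, 1, 2]"
  have V: "V \<in> prim_states"
    by (simp add: V_def prim_states_def)
  then have "\<psi> \<bullet> source e \<sigma>\<^sub>a (conserved e V) = 0"
    using \<psi> by (auto simp: collision_invariants_def O_W_def)
  then show "\<psi> \<in> {\<psi>. \<psi> $ 3 = \<psi> $ 4}"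
    using assms unfolding source_conserved[OF V] by (simp add: inner_vec_def sum_4 V_def)
next
  fix \<psi> :: "real^4" assume "\<psi> \<in> {\<psi>. \<psi> $ 3 = \<psi> $ 4}"
  then show "\<psi> \<in> collision_invariants e \<sigma>\<^sub>a"
    by (auto simp: collision_invariants_def O_W_def source_conserved inner_vec_def sum_4)
qed

lemma O_eq_iff_grad_entropy:
  assumes V: "V \<in> prim_states" and "\<sigma>\<^sub>a > 0"
  shows "conserved e V \<in> O_eq e \<sigma>\<^sub>a \<longleftrightarrow>
    grad (entropy e s) (conserved e V) \<in> collision_invariants e \<sigma>\<^sub>a"
proof -
  have pos: "V $ 3 > 0" "V $ 4 > 0" using state_pos[OF V] by auto
  have "V $ 4 = V $ 3 ^ 4 \<longleftrightarrow> V $ 4 powr (- (1 / 4)) = 1 / V $ 3"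
  proof
    assume "V $ 4 = V $ 3 ^ 4"
    then show "V $ 4 powr (- (1 / 4)) = 1 / V $ 3"
      by (simp only: fourth_power_powr(1)[OF pos(1)])
  next
    assume "V $ 4 powr (- (1 / 4)) = 1 / V $ 3"
    then have "V $ 4 powr (1 / 4) = V $ 3"
      using pos by (simp add: powr_minus_divide)
    moreover have "V $ 4 = (V $ 4 powr (1 / 4)) powr 4"
      using pos by (simp only: powr_powr) simp
    ultimately show "V $ 4 = V $ 3 ^ 4"
      using pos by simp
  qed
  then show ?thesis
    by (auto simp: O_eq_iff[OF assms] grad_entropy[OF V] collision_invariants_eq[OF assms(2)]
      entropy_variables_def Let_def)
qed

lemma pos_semidefinite_diffusion:
  assumes V: "V \<in> prim_states" and "\<sigma>\<^sub>s > 0"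
  shows "pos_semidefinite (diffusion \<sigma>\<^sub>s ** matrix_inv (hessian (entropy e s) (conserved e V)))"
proof -
  define k where "k = 4 * V $ 4 powr (5 / 4) / (3 * \<sigma>\<^sub>s)"
  have k: "k \<ge> 0" using assms(2) by (simp add: k_def)
  have "x \<bullet> (diag4 0 0 0 k *v x) = k * (x $ 4)\<^sup>2" for x
    by (simp add: diag4_def mat4_simps power2_eq_square)
  moreover have "symmetric_mat (diag4 0 0 0 k)"
    by (simp add: symmetric_mat_def diag4_def mat4_simps)
  ultimately show ?thesis
    using k unfolding diffusion_hessian_inv[OF V] k_def[symmetric]
    by (simp add: pos_semidefinite_def)
qed

end

theorem mainTheorem5:
  fixes p e s :: "real \<Rightarrow> real \<Rightarrow> real" and \<sigma>\<^sub>a \<sigma>\<^sub>s :: real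
  assumes smooth_p: "Cinf_on thermo_domain (\<lambda>(\<rho>, \<theta>). p \<rho> \<theta>)"
    and smooth_e: "Cinf_on thermo_domain (\<lambda>(\<rho>, \<theta>). e \<rho> \<theta>)"
    and smooth_s: "Cinf_on thermo_domain (\<lambda>(\<rho>, \<theta>). s \<rho> \<theta>)"
    and p_pos: "\<forall>(\<rho>, \<theta>)\<in>thermo_domain. p \<rho> \<theta> > 0"
    and p_rho_pos: "\<forall>(\<rho>, \<theta>)\<in>thermo_domain. d_rho p \<rho> \<theta> > 0"
    and p_theta_pos: "\<forall>(\<rho>, \<theta>)\<in>thermo_domain. d_theta p \<rho> \<theta> > 0"
    and e_theta_pos: "\<forall>(\<rho>, \<theta>)\<in>thermo_domain. d_theta e \<rho> \<theta> > 0"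
    and gibbs: "\<forall>(\<rho>, \<theta>)\<in>thermo_domain. gibbs_relation p e s \<rho> \<theta>"
    and e_rho: "\<forall>(\<rho>, \<theta>)\<in>thermo_domain. d_rho e \<rho> \<theta> = (p \<rho> \<theta> - \<theta> * d_theta p \<rho> \<theta>) / \<rho>\<^sup>2"
    and s_rho: "\<forall>(\<rho>, \<theta>)\<in>thermo_domain. d_rho s \<rho> \<theta> = - (d_theta p \<rho> \<theta> / \<rho>\<^sup>2)"
    and s_theta: "\<forall>(\<rho>, \<theta>)\<in>thermo_domain. d_theta s \<rho> \<theta> = d_theta e \<rho> \<theta> / \<theta>"
    and sigma_a_pos: "\<sigma>\<^sub>a > 0"
    and sigma_s_pos: "\<sigma>\<^sub>s > 0"
  shows
    "(\<forall>W\<in>O_W e.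
        entropy e s differentiable (at W) \<and> grad (entropy e s) differentiable (at W)
        \<and> flux p e differentiable (at W) \<and> source e \<sigma>\<^sub>a differentiable (at W))
     \<and> (\<forall>W\<in>O_W e. pos_definite (hessian (entropy e s) W))
     \<and> (\<forall>W\<in>O_eq e \<sigma>\<^sub>a. symmetric_mat
          ((jacobian (flux p e) (at W) - coupling e W) ** matrix_inv (hessian (entropy e s) W)))
     \<and> (\<forall>W\<in>O_W e.
          W \<in> O_eq e \<sigma>\<^sub>a \<longleftrightarrow> grad (entropy e s) W \<in> collision_invariants e \<sigma>\<^sub>a)
     \<and> (\<forall>W\<in>O_eq e \<sigma>\<^sub>a.
          nonpos_definite (jacobian (source e \<sigma>\<^sub>a) (at W) ** matrix_inv (hessian (entropy e s) W))
          \<and> null_space (jacobian (source e \<sigma>\<^sub>a) (at W) ** matrix_inv (hessian (entropy e s) W))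
            = collision_invariants e \<sigma>\<^sub>a)
     \<and> (\<forall>W\<in>O_W e. pos_semidefinite (diffusion \<sigma>\<^sub>s ** matrix_inv (hessian (entropy e s) W)))"
proof -
  interpret radiating_fluid p e s
    using assms by unfold_locales (auto simp: thermo_domain_def)
  have diff: "entropy e s differentiable (at W) \<and> grad (entropy e s) differentiable (at W)
      \<and> flux p e differentiable (at W) \<and> source e \<sigma>\<^sub>a differentiable (at W)" if "W \<in> O_W e" for W
    using that has_derivative_entropy has_derivative_grad_entropy has_derivative_flux has_derivative_source
    unfolding O_W_def differentiable_def by blast
  have eq: "\<exists>V\<in>prim_states. W = conserved e V \<and> V $ 4 = V $ 3 ^ 4" if W: "W \<in> O_eq e \<sigma>\<^sub>a" for W
  proof -
    from W obtain V where "V \<in> prim_states" "W = conserved e V"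
      by (auto simp: O_eq_def O_W_def)
    with W O_eq_iff[OF _ sigma_a_pos] show ?thesis by auto
  qed
  show ?thesis
  proof (intro conjI ballI)
    fix W assume "W \<in> O_eq e \<sigma>\<^sub>a"
    then obtain V where V: "V \<in> prim_states" "V $ 4 = V $ 3 ^ 4" and W: "W = conserved e V"
      using eq by blast
    show "symmetric_mat
        ((jacobian (flux p e) (at W) - coupling e W) ** matrix_inv (hessian (entropy e s) W))"
      unfolding W by (rule symmetric_flux[OF V])
    have "4 * \<sigma>\<^sub>a * V $ 3 ^ 5 > 0"
      using state_pos(2)[OF V(1)] sigma_a_pos by simp
    then show "nonpos_definite (jacobian (source e \<sigma>\<^sub>a) (at W) ** matrix_inv (hessian (entropy e s) W))"
      and "null_space (jacobian (source e \<sigma>\<^sub>a) (at W) ** matrix_inv (hessian (entropy e s) W))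
        = collision_invariants e \<sigma>\<^sub>a"
      by (simp_all add: W source_hessian_inv[OF V] nonpos_definite_exchange_mat null_space_exchange_mat
          collision_invariants_eq[OF sigma_a_pos])
  next
    fix W assume "W \<in> O_W e"
    then obtain V where V: "V \<in> prim_states" and W: "W = conserved e V"
      by (auto simp: O_W_def)
    show "pos_definite (hessian (entropy e s) W)"
      unfolding W by (rule pos_definite_hessian[OF V])
    show "W \<in> O_eq e \<sigma>\<^sub>a \<longleftrightarrow> grad (entropy e s) W \<in> collision_invariants e \<sigma>\<^sub>a"
      unfolding W by (rule O_eq_iff_grad_entropy[OF V sigma_a_pos])
    show "pos_semidefinite (diffusion \<sigma>\<^sub>s ** matrix_inv (hessian (entropy e s) W))"
      unfolding W by (rule pos_semidefinite_diffusion[OF V sigma_s_pos])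
  qed (use diff in blast)+
qed

end
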